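(* Let $X$ be a semigroup, $Y$ a set, and let $R\subseteq X\times Y$ be a residuated relation from $X$ to $Y$. Then the map $\mathsf{j}_R=R^{\downarrow}R^{\uparrow}\colon \mathsf{P}X\to\mathsf{P}X$ is a quantic nucleus on the quantale $\mathsf{P}X$.
   Context: A quantale is a complete lattice $Q$ with an associative binary operation $*$ preserving arbitrary suprema in each variable (no unit is assumed). For a semigroup $X$ (product written $xx'$), $\mathsf{P}X$ is the quantale of all subsets of $X$ ordered by inclusion, with multiplication $A*B=\{ab\mid a\in A,\ b\in B\}$. A quantic nucleus on a quantale $Q$ is a map $\mathsf{j}\colon Q\to Q$ such that for all $x,y\in Q$: $x\leq y\Rightarrow \mathsf{j}(x)\leq \mathsf{j}(y)$; $x\leq \mathsf{j}(x)$; $\mathsf{j}(\mathsf{j}(x))=\mathsf{j}(x)$; $\mathsf{j}(x)*\mathsf{j}(y)\leq \mathsf{j}(x*y)$. A relation from a set $X$ to a set $Y$ is a subset $R\subseteq X\times Y$; $xRy$ means $(x,y)\in R$. For $A\subseteq X$ and $B\subseteq Y$ put $R^{\uparrow}(A)=\{y\in Y\mid \forall a\in A,\ aRy\}$ and $R^{\downarrow}(B)=\{x\in X\mid \forall b\in B,\ xRb\}$. For a semigroup $X$ and a set $Y$, a relation $R\subseteq X\times Y$ is residuated if there exist maps $\swarrow\colon Y\times X\to Y$ and $\searrow\colon X\times Y\to Y$ such that $(xx')Ry\iff xR(y\swarrow x')\iff x'R(x\searrow y)$ for all $x,x'\in X$, $y\in Y$. *)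

theory Defs
  imports "HOL-Algebra.Complete_Lattice"
begin

text \<open>
  Semigroups, quantales and relations are given on explicit carriers, so that empty
  carriers are covered; only behaviour on the carriers matters.
\<close>

record 'a qstruct = "'a gorder" +
  qmult :: "['a, 'a] \<Rightarrow> 'a" (infixl \<open>\<star>\<index>\<close> 70)

locale quantale = complete_lattice Q for Q (structure) +
  assumes qmult_closed:
      "\<lbrakk>x \<in> carrier Q; y \<in> carrier Q\<rbrakk> \<Longrightarrow> x \<star> y \<in> carrier Q"
    and qmult_assoc:
      "\<lbrakk>x \<in> carrier Q; y \<in> carrier Q; z \<in> carrier Q\<rbrakk>
        \<Longrightarrow> (x \<star> y) \<star> z = x \<star> (y \<star> z)"
    and qmult_Sup_right:
      "\<lbrakk>x \<in> carrier Q; A \<subseteq> carrier Q\<rbrakk> \<Longrightarrow> x \<star> (\<Squnion>A) = \<Squnion>((\<lambda>a. x \<star> a) ` A)"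
    and qmult_Sup_left:
      "\<lbrakk>x \<in> carrier Q; A \<subseteq> carrier Q\<rbrakk> \<Longrightarrow> (\<Squnion>A) \<star> x = \<Squnion>((\<lambda>a. a \<star> x) ` A)"

locale quantic_nucleus = quantale Q for Q (structure) +
  fixes j :: "'a \<Rightarrow> 'a"
  assumes closed: "x \<in> carrier Q \<Longrightarrow> j x \<in> carrier Q"
    and monotone: "\<lbrakk>x \<in> carrier Q; y \<in> carrier Q; x \<sqsubseteq> y\<rbrakk> \<Longrightarrow> j x \<sqsubseteq> j y"
    and extensive: "x \<in> carrier Q \<Longrightarrow> x \<sqsubseteq> j x"
    and idempotent: "x \<in> carrier Q \<Longrightarrow> j (j x) = j x"
    and submultiplicative:
      "\<lbrakk>x \<in> carrier Q; y \<in> carrier Q\<rbrakk> \<Longrightarrow> j x \<star> j y \<sqsubseteq> j (x \<star> y)"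

locale semigroup_on =
  fixes X :: "'a set" and mult :: "'a \<Rightarrow> 'a \<Rightarrow> 'a"
  assumes mult_closed: "\<lbrakk>x \<in> X; y \<in> X\<rbrakk> \<Longrightarrow> mult x y \<in> X"
    and mult_assoc:
      "\<lbrakk>x \<in> X; y \<in> X; z \<in> X\<rbrakk> \<Longrightarrow> mult (mult x y) z = mult x (mult y z)"

definition powerset_quantale :: "'a set \<Rightarrow> ('a \<Rightarrow> 'a \<Rightarrow> 'a) \<Rightarrow> 'a set qstruct" where
  "powerset_quantale X mult =
    \<lparr>carrier = Pow X, eq = (=), le = (\<subseteq>),
     qmult = (\<lambda>A B. {mult a b | a b. a \<in> A \<and> b \<in> B})\<rparr>"

definition rel_up :: "'b set \<Rightarrow> ('a \<times> 'b) set \<Rightarrow> 'a set \<Rightarrow> 'b set" where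
  "rel_up Y R A = {y \<in> Y. \<forall>a\<in>A. (a, y) \<in> R}"

definition rel_down :: "'a set \<Rightarrow> ('a \<times> 'b) set \<Rightarrow> 'b set \<Rightarrow> 'a set" where
  "rel_down X R B = {x \<in> X. \<forall>b\<in>B. (x, b) \<in> R}"

definition nucleus_of_rel ::
  "'a set \<Rightarrow> 'b set \<Rightarrow> ('a \<times> 'b) set \<Rightarrow> 'a set \<Rightarrow> 'a set" where
  "nucleus_of_rel X Y R = rel_down X R \<circ> rel_up Y R"

definition residuated ::
  "'a set \<Rightarrow> ('a \<Rightarrow> 'a \<Rightarrow> 'a) \<Rightarrow> 'b set \<Rightarrow> ('a \<times> 'b) set \<Rightarrow> bool" where
  "residuated X mult Y R \<longleftrightarrow>
    (\<exists>(lres :: 'b \<Rightarrow> 'a \<Rightarrow> 'b) (rres :: 'a \<Rightarrow> 'b \<Rightarrow> 'b).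
      (\<forall>y\<in>Y. \<forall>x\<in>X. lres y x \<in> Y) \<and>
      (\<forall>x\<in>X. \<forall>y\<in>Y. rres x y \<in> Y) \<and>
      (\<forall>x\<in>X. \<forall>x'\<in>X. \<forall>y\<in>Y.
        ((mult x x', y) \<in> R \<longleftrightarrow> (x, lres y x') \<in> R) \<and>
        ((x, lres y x') \<in> R \<longleftrightarrow> (x', rres x y) \<in> R)))"

end

theory Submission
  imports Defs
begin

text \<open>
  For \<open>x \<in> j A\<close>, \<open>x' \<in> j B\<close> and a bound \<open>y\<close> of \<open>A * B\<close>, residuation lets one factor be
  replaced at a time: for each \<open>b \<in> B\<close> the element \<open>y \<swarrow> b\<close> bounds \<open>A\<close>, hence is related to \<open>x\<close>;
  therefore \<open>x \<searrow> y\<close> bounds \<open>B\<close>, hence is related to \<open>x'\<close>, which says \<open>(xx') R y\<close>.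
\<close>

lemma powerset_quantale_simps [simp]:
  "carrier (powerset_quantale X mult) = Pow X"
  "gorder.le (powerset_quantale X mult) = (\<subseteq>)"
  "eq (powerset_quantale X mult) = (=)"
  "qmult (powerset_quantale X mult) = (\<lambda>A B. {mult a b | a b. a \<in> A \<and> b \<in> B})"
  by (simp_all add: powerset_quantale_def)

lemma least_powerset_quantale_Union:
  assumes "\<A> \<subseteq> Pow X"
  shows "least (powerset_quantale X mult) (\<Union>\<A>) (Upper (powerset_quantale X mult) \<A>)"
  using assms by (fastforce simp: least_def Upper_def)

lemma partial_order_powerset_quantale: "partial_order (powerset_quantale X mult)"
  by unfold_locales auto

lemma complete_lattice_powerset_quantale: "complete_lattice (powerset_quantale X mult)"
proof -
  interpret partial_order "powerset_quantale X mult"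
    by (rule partial_order_powerset_quantale)
  show ?thesis
  proof (rule complete_latticeI)
    fix \<A> assume "\<A> \<subseteq> carrier (powerset_quantale X mult)"
    \<comment> \<open>Intersecting with \<open>X\<close> matters for the empty family: there
      \<open>\<Inter>\<A>\<close> is the whole type, while the top element has to be
      \<open>X\<close>.\<close>
    then have "greatest (powerset_quantale X mult) (X \<inter> \<Inter>\<A>) (Lower (powerset_quantale X mult) \<A>)"
      by (fastforce simp: greatest_def Lower_def)
    then show "\<exists>i. greatest (powerset_quantale X mult) i (Lower (powerset_quantale X mult) \<A>)" ..
  next
    fix \<A> assume "\<A> \<subseteq> carrier (powerset_quantale X mult)"
    then have "least (powerset_quantale X mult) (\<Union>\<A>) (Upper (powerset_quantale X mult) \<A>)"
      by (simp add: least_powerset_quantale_Union)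
    then show "\<exists>s. least (powerset_quantale X mult) s (Upper (powerset_quantale X mult) \<A>)" ..
  qed
qed

text \<open>\<open>sup_def\<close> picks some least upper bound by Hilbert choice. Least upper
  bounds are unique in a partial order, so the choice can only be the union. This makes the abstract
  suprema in the quantale axioms concrete.\<close>

lemma supr_powerset_quantale:
  assumes "\<A> \<subseteq> Pow X"
  shows "\<Squnion>\<^bsub>powerset_quantale X mult\<^esub>\<A> = \<Union>\<A>"
proof -
  interpret partial_order "powerset_quantale X mult"
    by (rule partial_order_powerset_quantale)
  show ?thesis
    unfolding sup_def
    by (rule some_equality) (rule least_powerset_quantale_Union[OF assms],
      erule least_unique, rule least_powerset_quantale_Union[OF assms])
qed

lemma quantale_powerset_quantale:
  assumes "semigroup_on X mult"
  shows "quantale (powerset_quantale X mult)"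
proof -
  interpret semigroup_on X mult by fact
  interpret complete_lattice "powerset_quantale X mult"
    by (rule complete_lattice_powerset_quantale)
  show ?thesis
  proof (unfold_locales, simp_all)
    fix A B assume "A \<subseteq> X" "B \<subseteq> X"
    then show "{mult a b | a b. a \<in> A \<and> b \<in> B} \<subseteq> X"
      using mult_closed by blast
  next
    fix A B C assume *: "A \<subseteq> X" "B \<subseteq> X" "C \<subseteq> X"
    have assoc: "mult (mult a b) c = mult a (mult b c)" if "a \<in> A" "b \<in> B" "c \<in> C" for a b c
      using that * mult_assoc by blast
    \<comment> \<open>Both iterated products are brought into the form of nested unions of
      singletons. Inside these the memberships of \<open>a\<close>, \<open>b\<close> and
      \<open>c\<close> are available, so the conditional rule \<open>assoc\<close> can
      rewrite.\<close>
    have "{mult ab c | ab c. (\<exists>a b. ab = mult a b \<and> a \<in> A \<and> b \<in> B) \<and> c \<in> C} =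
        (\<Union>a\<in>A. \<Union>b\<in>B. \<Union>c\<in>C. {mult (mult a b) c})"
      by blast
    also have "\<dots> = (\<Union>a\<in>A. \<Union>b\<in>B. \<Union>c\<in>C. {mult a (mult b c)})"
      by (simp add: assoc)
    also have "\<dots> = {mult a bc | a bc. a \<in> A \<and> (\<exists>b c. bc = mult b c \<and> b \<in> B \<and> c \<in> C)}"
      by blast
    finally show "{mult ab c | ab c. (\<exists>a b. ab = mult a b \<and> a \<in> A \<and> b \<in> B) \<and> c \<in> C} =
        {mult a bc | a bc. a \<in> A \<and> (\<exists>b c. bc = mult b c \<and> b \<in> B \<and> c \<in> C)}" .
  next
    fix A \<B> assume *: "A \<subseteq> X" "\<B> \<subseteq> Pow X"
    \<comment> \<open>The identification of suprema with unions is conditional on families of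
      subsets of \<open>X\<close>; the right-hand supremum runs over this image family.\<close>
    then have "(\<lambda>B. {mult a b | a b. a \<in> A \<and> b \<in> B}) ` \<B> \<subseteq> Pow X"
      using mult_closed by blast
    with * show "{mult a b | a b. a \<in> A \<and> b \<in> \<Squnion>\<^bsub>powerset_quantale X mult\<^esub>\<B>} =
        \<Squnion>\<^bsub>powerset_quantale X mult\<^esub>((\<lambda>B. {mult a b | a b. a \<in> A \<and> b \<in> B}) ` \<B>)"
      by (simp only: supr_powerset_quantale) blast
  next
    fix A \<B> assume *: "A \<subseteq> X" "\<B> \<subseteq> Pow X"
    then have "(\<lambda>B. {mult b a | b a. b \<in> B \<and> a \<in> A}) ` \<B> \<subseteq> Pow X"
      using mult_closed by blast
    with * show "{mult b a | b a. b \<in> \<Squnion>\<^bsub>powerset_quantale X mult\<^esub>\<B> \<and> a \<in> A} =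
        \<Squnion>\<^bsub>powerset_quantale X mult\<^esub>((\<lambda>B. {mult b a | b a. b \<in> B \<and> a \<in> A}) ` \<B>)"
      by (simp only: supr_powerset_quantale) blast
  qed
qed

text \<open>Reading \<open>y\<close> as a bound of \<open>A\<close> when all of \<open>A\<close> is
  related to it, this reduces the nucleus axioms to reasoning about bounds.\<close>

lemma mem_nucleus_of_rel:
  "x \<in> nucleus_of_rel X Y R A \<longleftrightarrow> x \<in> X \<and> (\<forall>y\<in>Y. (\<forall>a\<in>A. (a, y) \<in> R) \<longrightarrow> (x, y) \<in> R)"
  by (auto simp: nucleus_of_rel_def rel_down_def rel_up_def)

text \<open>Elementwise form of the multiplicative nucleus axiom. Residuation enters here: it turns
  a bound of products into bounds of the separate factors.\<close>

lemma nucleus_of_rel_submultiplicative: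
  fixes X :: "'a set" and Y :: "'b set"
  assumes "semigroup_on X mult" and "residuated X mult Y R" and "A \<subseteq> X" and "B \<subseteq> X"
    and x: "x \<in> nucleus_of_rel X Y R A" and x': "x' \<in> nucleus_of_rel X Y R B"
  shows "mult x x' \<in> nucleus_of_rel X Y R {mult a b | a b. a \<in> A \<and> b \<in> B}"
proof -
  interpret semigroup_on X mult by fact
  obtain lres :: "'b \<Rightarrow> 'a \<Rightarrow> 'b" and rres :: "'a \<Rightarrow> 'b \<Rightarrow> 'b" where
    lres_closed: "\<forall>y\<in>Y. \<forall>x\<in>X. lres y x \<in> Y" and
    rres_closed: "\<forall>x\<in>X. \<forall>y\<in>Y. rres x y \<in> Y" and
    res: "\<forall>x\<in>X. \<forall>x'\<in>X. \<forall>y\<in>Y. ((mult x x', y) \<in> R \<longleftrightarrow> (x, lres y x') \<in> R) \<and>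
      ((x, lres y x') \<in> R \<longleftrightarrow> (x', rres x y) \<in> R)"
    using \<open>residuated X mult Y R\<close> unfolding residuated_def by (elim exE conjE)
  have lres: "(mult x x', y) \<in> R \<longleftrightarrow> (x, lres y x') \<in> R"
    and rres: "(mult x x', y) \<in> R \<longleftrightarrow> (x', rres x y) \<in> R"
    if "x \<in> X" "x' \<in> X" "y \<in> Y" for x x' y
    using res that by simp_all
  have X: "x \<in> X" "x' \<in> X"
    using x x' by (simp_all add: mem_nucleus_of_rel)
  have "(mult x x', y) \<in> R"
    if y: "y \<in> Y" and bound: "\<And>a b. \<lbrakk>a \<in> A; b \<in> B\<rbrakk> \<Longrightarrow> (mult a b, y) \<in> R" for y
  proof -
    have "(b, rres x y) \<in> R" if b: "b \<in> B" for b
    proof -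
      have "b \<in> X"
        using b \<open>B \<subseteq> X\<close> by blast
      have "\<forall>a\<in>A. (a, lres y b) \<in> R"
        using bound b \<open>b \<in> X\<close> \<open>A \<subseteq> X\<close> y by (simp add: lres[symmetric] subset_iff)
      then have "(x, lres y b) \<in> R"
        using x lres_closed \<open>b \<in> X\<close> y by (simp add: mem_nucleus_of_rel)
      \<comment> \<open>The two residuals meet at \<open>(mult x b, y) \<in> R\<close>:
        \<open>lres\<close> puts \<open>b\<close> back as right factor, then \<open>rres\<close>
        removes \<open>x\<close> on the left.\<close>
      then show ?thesis
        using lres rres X \<open>b \<in> X\<close> y by simp
    qed
    then have "(x', rres x y) \<in> R"
      using x' rres_closed X y by (simp add: mem_nucleus_of_rel)
    then show ?thesis
      using rres X y by simp
  qed
  \<comment> \<open>Turns a bound of the product set into the pairwise form assumed as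
    \<open>bound\<close> above.\<close>
  moreover have "(mult a b, y) \<in> R"
    if "\<forall>c\<in>{mult a b | a b. a \<in> A \<and> b \<in> B}. (c, y) \<in> R" "a \<in> A" "b \<in> B" for a b y
    using that by auto
  ultimately show ?thesis
    using X mult_closed by (simp add: mem_nucleus_of_rel)
qed

theorem proposition4p2:
  fixes X :: "'a set" and mult :: "'a \<Rightarrow> 'a \<Rightarrow> 'a"
    and Y :: "'b set" and R :: "('a \<times> 'b) set"
  assumes "semigroup_on X mult"
    and "R \<subseteq> X \<times> Y"
    and "residuated X mult Y R"
  shows "quantic_nucleus (powerset_quantale X mult) (nucleus_of_rel X Y R)"
proof -
  let ?j = "nucleus_of_rel X Y R"
  interpret quantale "powerset_quantale X mult"
    using assms(1) by (rule quantale_powerset_quantale)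
  show ?thesis
  proof (unfold_locales, simp_all)
    fix A
    \<comment> \<open>For idempotence, every bound of \<open>A\<close> also bounds
      \<open>?j A\<close>, which gives \<open>?j (?j A) \<subseteq> ?j A\<close>; the converse is
      extensivity at \<open>?j A\<close>.\<close>
    show "?j A \<subseteq> X" "?j (?j A) = ?j A"
      by (auto simp: mem_nucleus_of_rel)
    show "A \<subseteq> ?j A" if "A \<subseteq> X"
      using that by (auto simp: mem_nucleus_of_rel)
    fix B
    \<comment> \<open>A larger set has fewer bounds, and fewer bounds impose fewer conditions on
      members.\<close>
    show "?j A \<subseteq> ?j B" if "A \<subseteq> B"
      using that by (fastforce simp: mem_nucleus_of_rel)
    show "{mult a b | a b. a \<in> ?j A \<and> b \<in> ?j B} \<subseteq> ?j {mult a b | a b. a \<in> A \<and> b \<in> B}"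
      if "A \<subseteq> X" "B \<subseteq> X"
      using nucleus_of_rel_submultiplicative[OF assms(1,3) that] by blast
  qed
qed

end
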